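(* Let $0\le\mu\le 1/2$ and $C\in\mathbb{R}$, and let $H(u,U)$ be the Hamiltonian of the planar restricted equilateral four-body problem with $\mu_1=1-2\mu$, $\mu_2=\mu_3=\mu$ given in the context, with primaries at $u_1=\frac{\sqrt3}{2}$, $u_2=-\frac{i}{2}$, $u_3=\frac{i}{2}$. Let $$u=f(w)=\frac12\left(w-\frac{1}{4w}\right),\qquad U=\frac{W}{\overline{f^{*}(w)}},\qquad \frac{d\tau}{dt}=\frac{1}{|f^{*}(w)|^{2}},$$ where $f^{*}$ denotes the complex derivative of $f$, and put $a_1=1+\frac{\sqrt3}{2}$, $a_2=-1+\frac{\sqrt3}{2}$. For $w\notin\{0,a_1,a_2,u_2,u_3\}$ and $W\in\mathbb{C}$ define $$\overline{H}(w,W)=|f^{*}(w)|^{2}\left(H\!\left(f(w),\tfrac{W}{\overline{f^{*}(w)}}\right)+\frac{C}{2}\right).$$ Then: (i) The energy level $H=-C/2$ is carried to the level $\overline{H}=0$, and solutions of the Hamiltonian system of $H$ (with time $t$) on the level $H=-C/2$ correspond, after the time rescaling above, to solutions of the Hamiltonian system of $\overline{H}$ (with time $\tau$) on the level $\overline{H}=0$, as long as $w\notin\{0,a_1,a_2,u_2,u_3\}$. (ii) One has $$\overline{H}(w,W)=\frac12|W|^{2}+\operatorname{Im}\!\left(\Big(f(w)+\sqrt3\mu-\tfrac{\sqrt3}{2}\Big)\overline{f^{*}(w)W}\right)-|f^{*}(w)|^{2}\,V+|f^{*}(w)|^{2}\frac{C}{2},$$ where $V=\sum_{i=1}^{3}\frac{\mu_i}{|f(w)-u_i|}$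 and $$|f^{*}(w)|^{2}V=\frac{1}{2|w|^{3}}\left(\frac{(1-2\mu)\,|w-u_2|^{2}|w-u_3|^{2}}{|w-a_1|\,|w-a_2|}+\mu\left(|w-u_2|^{2}+|w-u_3|^{2}\right)\right).$$ (iii) Consequently the singularities due to binary collisions of the massless body with $m_2$ and with $m_3$ (that is, at $w=u_2$ and $w=u_3$) are removed simultaneously: $\overline{H}$ extends, by these formulas, to a function with continuous partial derivatives on all of $$\overline{\Delta}=\{(w,W)\in\mathbb{C}\times\mathbb{C} : w\notin\{0,a_1,a_2\}\}.$$
   Context: The restricted equilateral four-body problem: three primaries $m_1,m_2,m_3$ with normalized masses $\mu_1=1-2\mu$, $\mu_2=\mu_3=\mu$ sit at the vertices of an equilateral triangle of side $1$ that is fixed in a uniformly rotating frame; a massless particle moves in the same plane under their Newtonian attraction. With position $z=x+iy\in\mathbb{C}$ relative to the center of mass and conjugate momentum $P=p_x+ip_y$, the motion is Hamiltonian with $H=\frac12|P|^2+\operatorname{Im}(z\overline{P})-\sum_{i=1}^3\frac{\mu_i}{|z-z_i|}$, where $z_1=\sqrt3\mu$, $z_2=-\frac{\sqrt3(1-2\mu)}{2}-\frac{i}{2}$, $z_3=-\frac{\sqrt3(1-2\mu)}{2}+\frac{i}{2}$. Here $C$ denotes the value of the Jacobi constant, related to the energy by $H=-C/2$. After the translation $z=u+\sqrt3\mu-\frac{\sqrt3}{2}$, $U=P$, the primaries are at $u_1=\frac{\sqrt3}{2}$, $u_2=-\frac{i}{2}$, $u_3=\frac{i}{2}$ and $$H(u,U)=\frac12|U|^{2}+\operatorname{Im}\!\left(\Big(u+\sqrt3\mu-\tfrac{\sqrt3}{2}\Big)\overline{U}\right)-\sum_{i=1}^{3}\frac{\mu_i}{|u-u_i|},\qquad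 u\notin\{u_1,u_2,u_3\}.$$ Hamiltonian systems in a complex pair $(q,p)$ of position and conjugate momentum are understood in the real canonical coordinates $(\operatorname{Re}q,\operatorname{Im}q;\operatorname{Re}p,\operatorname{Im}p)$: $\dot q=\frac{\partial H}{\partial \operatorname{Re}p}+i\frac{\partial H}{\partial \operatorname{Im}p}$, $\dot p=-\frac{\partial H}{\partial \operatorname{Re}q}-i\frac{\partial H}{\partial \operatorname{Im}q}$. Partial derivatives in (iii) are with respect to these real coordinates of $(w,W)$. *)

theory Defs
  imports "HOL-Analysis.Analysis"
begin

definition u\<^sub>1 :: complex where "u\<^sub>1 = complex_of_real (sqrt 3 / 2)"
definition u\<^sub>2 :: complex where "u\<^sub>2 = - \<i> / 2"
definition u\<^sub>3 :: complex where "u\<^sub>3 = \<i> / 2"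

definition a\<^sub>1 :: complex where "a\<^sub>1 = complex_of_real (1 + sqrt 3 / 2)"
definition a\<^sub>2 :: complex where "a\<^sub>2 = complex_of_real (- 1 + sqrt 3 / 2)"

definition potential :: "real \<Rightarrow> complex \<Rightarrow> real" where
  "potential \<mu> u = (1 - 2 * \<mu>) / cmod (u - u\<^sub>1) + \<mu> / cmod (u - u\<^sub>2) + \<mu> / cmod (u - u\<^sub>3)"

text \<open>Division is total, so the functions below have meaningless values where a denominator vanishes;
  the positions concerned have to be excluded wherever the functions are used.\<close>

definition hamiltonian :: "real \<Rightarrow> complex \<Rightarrow> complex \<Rightarrow> real" where
  "hamiltonian \<mu> u U =
     (cmod U)\<^sup>2 / 2
     + Im ((u + complex_of_real (sqrt 3 * \<mu> - sqrt 3 / 2)) * cnj U)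
     - potential \<mu> u"

definition f_reg :: "complex \<Rightarrow> complex" where
  "f_reg w = (w - 1 / (4 * w)) / 2"

abbreviation f_star :: "complex \<Rightarrow> complex" where
  "f_star \<equiv> deriv f_reg"

definition H_bar :: "real \<Rightarrow> real \<Rightarrow> complex \<Rightarrow> complex \<Rightarrow> real" where
  "H_bar \<mu> C w W =
     (cmod (f_star w))\<^sup>2 * (hamiltonian \<mu> (f_reg w) (W / cnj (f_star w)) + C / 2)"

definition sing :: "complex set" where "sing = {u\<^sub>1, u\<^sub>2, u\<^sub>3}"
definition sing_bar :: "complex set" where "sing_bar = {0, a\<^sub>1, a\<^sub>2, u\<^sub>2, u\<^sub>3}"

definition potential_reg :: "real \<Rightarrow> complex \<Rightarrow> real" where
  "potential_reg \<mu> w =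
     1 / (2 * (cmod w) ^ 3) *
       ((1 - 2 * \<mu>) * (cmod (w - u\<^sub>2))\<^sup>2 * (cmod (w - u\<^sub>3))\<^sup>2 / (cmod (w - a\<^sub>1) * cmod (w - a\<^sub>2))
        + \<mu> * ((cmod (w - u\<^sub>2))\<^sup>2 + (cmod (w - u\<^sub>3))\<^sup>2))"

definition H_ext :: "real \<Rightarrow> real \<Rightarrow> complex \<Rightarrow> complex \<Rightarrow> real" where
  "H_ext \<mu> C w W =
     (cmod W)\<^sup>2 / 2
     + Im ((f_reg w + complex_of_real (sqrt 3 * \<mu> - sqrt 3 / 2)) * cnj (f_star w * W))
     - potential_reg \<mu> w
     + (cmod (f_star w))\<^sup>2 * (C / 2)"

text \<open>The four real partial derivatives of \<open>F\<close> at \<open>(q, p)\<close> exist; they are collected in two complex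
  numbers, \<open>G = \<partial>F/\<partial>Re q + \<i> \<partial>F/\<partial>Im q\<close> and \<open>K = \<partial>F/\<partial>Re p + \<i> \<partial>F/\<partial>Im p\<close>.\<close>

definition has_partials ::
  "(complex \<Rightarrow> complex \<Rightarrow> real) \<Rightarrow> complex \<Rightarrow> complex \<Rightarrow> complex \<Rightarrow> complex \<Rightarrow> bool" where
  "has_partials F q p G K \<longleftrightarrow>
     ((\<lambda>x. F (Complex x (Im q)) p) has_real_derivative Re G) (at (Re q)) \<and>
     ((\<lambda>y. F (Complex (Re q) y) p) has_real_derivative Im G) (at (Im q)) \<and>
     ((\<lambda>x. F q (Complex x (Im p))) has_real_derivative Re K) (at (Re p)) \<and>
     ((\<lambda>y. F q (Complex (Re p) y)) has_real_derivative Im K) (at (Im p))"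

text \<open>\<open>S\<close> is the set of excluded positions.\<close>

definition hamiltonian_solution ::
  "complex set \<Rightarrow> (complex \<Rightarrow> complex \<Rightarrow> real) \<Rightarrow> real set
    \<Rightarrow> (real \<Rightarrow> complex) \<Rightarrow> (real \<Rightarrow> complex) \<Rightarrow> bool" where
  "hamiltonian_solution S F I q p \<longleftrightarrow>
     (\<forall>t\<in>I. q t \<notin> S \<and>
        (\<exists>G K. has_partials F (q t) (p t) G K \<and>
           (q has_vector_derivative K) (at t) \<and>
           (p has_vector_derivative - G) (at t)))"

definition solution_on_level ::
  "complex set \<Rightarrow> (complex \<Rightarrow> complex \<Rightarrow> real) \<Rightarrow> real \<Rightarrow> real set
    \<Rightarrow> (real \<Rightarrow> complex) \<Rightarrow> (real \<Rightarrow> complex) \<Rightarrow> bool" where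
  "solution_on_level S F c I q p \<longleftrightarrow>
     hamiltonian_solution S F I q p \<and> (\<forall>t\<in>I. F (q t) (p t) = c)"

text \<open>\<open>\<sigma>\<close> is the new time \<open>\<tau>\<close> as a function of \<open>t\<close>. The map \<open>f_reg\<close> is two-to-one, so \<open>w\<close> has to be
  a continuous lift of \<open>u\<close>; a lift that jumps between the two preimages is excluded.\<close>

definition corresponding_curves ::
  "real set \<Rightarrow> real set \<Rightarrow> (real \<Rightarrow> real) \<Rightarrow> (real \<Rightarrow> complex) \<Rightarrow> (real \<Rightarrow> complex)
    \<Rightarrow> (real \<Rightarrow> complex) \<Rightarrow> (real \<Rightarrow> complex) \<Rightarrow> bool" where
  "corresponding_curves I J \<sigma> u U w W \<longleftrightarrow>
     open I \<and> is_interval I \<and> open J \<and> is_interval J \<and> bij_betw \<sigma> I J \<and>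
     continuous_on J w \<and> (\<forall>\<tau>\<in>J. w \<tau> \<notin> sing_bar) \<and>
     (\<forall>t\<in>I. (\<sigma> has_real_derivative 1 / (cmod (f_star (w (\<sigma> t))))\<^sup>2) (at t) \<and>
        u t = f_reg (w (\<sigma> t)) \<and>
        U t = W (\<sigma> t) / cnj (f_star (w (\<sigma> t))))"

end

theory Submission
  imports Defs
begin

text \<open>The map \<open>f_reg\<close> is a rotated and scaled Joukowski map: \<open>f_reg w - u\<^sub>i = (w - u\<^sub>i)\<^sup>2 / (2 * w)\<close>
  for the two primaries \<open>i = 2, 3\<close> of equal mass, so both are critical values, and
  \<open>f_star w = (w - u\<^sub>2) * (w - u\<^sub>3) / (2 * w\<^sup>2)\<close>. Near \<open>u\<^sub>2\<close> the factor \<open>\<bar>f_star w\<bar>\<^sup>2\<close> vanishes to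
  second order, exactly the order of the pole of the pulled back potential, and likewise near \<open>u\<^sub>3\<close>.
  Since all these expressions factor, the regularized potential is an explicit quotient of distances
  (\<open>potential_regularized\<close>), and the closed form of the new Hamiltonian is continuously
  differentiable wherever \<open>w\<close> avoids \<open>0\<close>, \<open>a\<^sub>1\<close>, \<open>a\<^sub>2\<close> (\<open>C1_H_ext\<close>).

  For the solutions there are two classical facts. The substitution \<open>u = f_reg w\<close>,
  \<open>U = W / cnj (f_star w)\<close> is canonical, being the lift of a point transformation to the momenta.
  Multiplying a Hamiltonian that vanishes on a level by a positive function only rescales the
  vector field on that level, because the derivative of the factor is multiplied by zero. Together
  they give the gradient of the new Hamiltonian in terms of that of the old one
  (\<open>GDERIV_rescaled\<close>), and comparing derivatives along the curves proves that solutions correspond to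
  solutions (\<open>corresponding_solutions\<close>).

  It remains to produce the corresponding curves. The new time is an antiderivative with positive
  integrand, hence invertible with differentiable inverse (\<open>antiderivative_on_interval\<close>,
  \<open>increasing_on_interval\<close>). A physical solution is lifted through the two-to-one map \<open>f_reg\<close> by
  choosing a continuous square root of \<open>u\<^sup>2 + 1 / 4\<close> (\<open>f_reg_path_lift\<close>); the lift is differentiable
  because \<open>f_star\<close> does not vanish along it (\<open>has_vector_derivative_lift\<close>).\<close>

section \<open>The regularizing map\<close>

text \<open>The two quadratics for \<open>u\<^sub>2\<close> and \<open>u\<^sub>3\<close> are perfect squares: these two primaries are the critical
  values of \<open>f_reg\<close>, each with itself as the only preimage, whereas \<open>u\<^sub>1\<close> is a regular value with the
  two preimages \<open>a\<^sub>1\<close>, \<open>a\<^sub>2\<close>. At a double zero the derivative vanishes as well,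
  so \<open>\<bar>f_star w\<bar>\<^sup>2\<close> has a zero there of the same order as the pole of the potential.\<close>

lemma regularization_zeros:
  assumes "w \<noteq> 0"
  shows "f_reg w - u\<^sub>1 = (w - a\<^sub>1) * (w - a\<^sub>2) / (2 * w)"
    and "f_reg w - u\<^sub>2 = (w - u\<^sub>2)\<^sup>2 / (2 * w)"
    and "f_reg w - u\<^sub>3 = (w - u\<^sub>3)\<^sup>2 / (2 * w)"
proof -
  have "complex_of_real (sqrt 3) * complex_of_real (sqrt 3) = 3"
    by (metis abs_numeral of_real_mult of_real_numeral real_sqrt_mult_self)
  then have "a\<^sub>1 * a\<^sub>2 = - 1 / 4" and "a\<^sub>1 + a\<^sub>2 = 2 * u\<^sub>1"
    by (simp_all add: a\<^sub>1_def a\<^sub>2_def u\<^sub>1_def field_simps)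
  moreover have "(w - a\<^sub>1) * (w - a\<^sub>2) = w\<^sup>2 - (a\<^sub>1 + a\<^sub>2) * w + a\<^sub>1 * a\<^sub>2"
    by (simp add: algebra_simps power2_eq_square)
  ultimately have "(w - a\<^sub>1) * (w - a\<^sub>2) = w\<^sup>2 - 2 * u\<^sub>1 * w - 1 / 4"
    by simp
  moreover have "f_reg w - u\<^sub>1 = (w\<^sup>2 - 2 * u\<^sub>1 * w - 1 / 4) / (2 * w)"
    using assms by (simp add: f_reg_def divide_simps power2_eq_square)
  ultimately show "f_reg w - u\<^sub>1 = (w - a\<^sub>1) * (w - a\<^sub>2) / (2 * w)"
    by (simp only:)
  show "f_reg w - u\<^sub>2 = (w - u\<^sub>2)\<^sup>2 / (2 * w)" "f_reg w - u\<^sub>3 = (w - u\<^sub>3)\<^sup>2 / (2 * w)"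
    using assms by (simp_all add: f_reg_def u\<^sub>2_def u\<^sub>3_def divide_simps power2_eq_square)
      (simp_all add: algebra_simps)
qed

lemma f_reg_has_derivative:
  assumes "w \<noteq> 0"
  shows "(f_reg has_field_derivative (w - u\<^sub>2) * (w - u\<^sub>3) / (2 * w\<^sup>2)) (at w)"
  unfolding f_reg_def[abs_def] using assms
  by (auto intro!: derivative_eq_intros simp: u\<^sub>2_def u\<^sub>3_def field_simps power2_eq_square)

lemma f_star_eq: "w \<noteq> 0 \<Longrightarrow> f_star w = (w - u\<^sub>2) * (w - u\<^sub>3) / (2 * w\<^sup>2)"
  by (rule DERIV_imp_deriv[OF f_reg_has_derivative])

lemma f_star_has_derivative:
  assumes "w \<noteq> 0"
  shows "(f_star has_field_derivative - 1 / (4 * w ^ 3)) (at w)"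
proof (rule has_field_derivative_transform_within_open[where S = "- {0}"])
  show "((\<lambda>w. (w - u\<^sub>2) * (w - u\<^sub>3) / (2 * w\<^sup>2)) has_field_derivative - 1 / (4 * w ^ 3)) (at w)"
    using assms
    by (auto intro!: derivative_eq_intros simp: u\<^sub>2_def u\<^sub>3_def field_simps eval_nat_numeral)
qed (use assms in \<open>auto simp: f_star_eq\<close>)

lemma special_points_nonzero:
  "u\<^sub>2 \<noteq> 0" "u\<^sub>3 \<noteq> 0" "a\<^sub>1 \<noteq> 0" "a\<^sub>2 \<noteq> 0"
proof -
  have "sqrt 3 < 2" by (rule real_less_lsqrt) auto
  moreover have "0 \<le> sqrt (3 :: real)" by simp
  ultimately have "- 1 + sqrt 3 / 2 \<noteq> (0 :: real)" "1 + sqrt 3 / 2 \<noteq> (0 :: real)" by linarith+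
  then show "a\<^sub>1 \<noteq> 0" "a\<^sub>2 \<noteq> 0" unfolding a\<^sub>1_def a\<^sub>2_def of_real_eq_0_iff by blast+
qed (auto simp: u\<^sub>2_def u\<^sub>3_def)

lemma f_reg_in_sing_iff:
  assumes "w \<noteq> 0"
  shows "f_reg w = u\<^sub>1 \<longleftrightarrow> w = a\<^sub>1 \<or> w = a\<^sub>2"
    and "f_reg w = u\<^sub>2 \<longleftrightarrow> w = u\<^sub>2" and "f_reg w = u\<^sub>3 \<longleftrightarrow> w = u\<^sub>3"
  using assms by (subst right_minus_eq[symmetric], simp add: regularization_zeros)+

text \<open>The excluded positions are exactly the pole of \<open>f_reg\<close> and the preimages of the primaries, so
  \<open>f_reg\<close> restricts to a surjection between the two configuration spaces.\<close>

lemma not_sing_bar_iff: "w \<notin> sing_bar \<longleftrightarrow> w \<noteq> 0 \<and> f_reg w \<notin> sing"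
  using f_reg_in_sing_iff[of w] by (auto simp: sing_bar_def sing_def special_points_nonzero)

lemma f_star_nonzero: "w \<notin> sing_bar \<Longrightarrow> f_star w \<noteq> 0"
  by (auto simp: f_star_eq sing_bar_def)

text \<open>In terms of the distances of \<open>w\<close> to the five special points both sides are rational, since the
  numerators and denominators of \<open>f_reg w - u\<^sub>i\<close> and \<open>f_star w\<close> factor completely.\<close>

lemma potential_regularized:
  assumes "w \<notin> sing_bar"
  shows "(cmod (f_star w))\<^sup>2 * potential \<mu> (f_reg w) = potential_reg \<mu> w"
proof -
  have nz: "w \<noteq> 0" "w \<noteq> a\<^sub>1" "w \<noteq> a\<^sub>2" "w \<noteq> u\<^sub>2" "w \<noteq> u\<^sub>3"
    using assms by (auto simp: sing_bar_def)
  define r A B P Q where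
    "r = cmod w" and "A = cmod (w - a\<^sub>1)" and "B = cmod (w - a\<^sub>2)"
    and "P = cmod (w - u\<^sub>2)" and "Q = cmod (w - u\<^sub>3)"
  have pos: "r > 0" "A > 0" "B > 0" "P > 0" "Q > 0"
    using nz by (auto simp: r_def A_def B_def P_def Q_def)
  have "(cmod (f_star w))\<^sup>2 * potential \<mu> (f_reg w)
      = (P * Q / (2 * r\<^sup>2))\<^sup>2 * ((1 - 2 * \<mu>) / (A * B / (2 * r)) + \<mu> / (P\<^sup>2 / (2 * r)) + \<mu> / (Q\<^sup>2 / (2 * r)))"
    by (simp add: f_star_eq[OF nz(1)] potential_def regularization_zeros[OF nz(1)]
        norm_divide norm_mult norm_power r_def A_def B_def P_def Q_def)
  also have "\<dots> = 1 / (2 * r ^ 3) * ((1 - 2 * \<mu>) * P\<^sup>2 * Q\<^sup>2 / (A * B) + \<mu> * (P\<^sup>2 + Q\<^sup>2))"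
    using pos by (simp add: divide_simps eval_nat_numeral) (simp add: algebra_simps)
  finally show ?thesis
    by (simp add: potential_reg_def r_def A_def B_def P_def Q_def)
qed

text \<open>The momentum substitution divides by \<open>cnj (f_star w)\<close>, so the factor \<open>f_star w * cnj (f_star w)\<close>
  leaves no factor in the kinetic term and the factor \<open>cnj (f_star w)\<close> in the Coriolis term.\<close>

lemma H_bar_eq:
  assumes "w \<notin> sing_bar"
  shows "H_bar \<mu> C w W = H_ext \<mu> C w W"
proof -
  define d where "d = f_star w"
  define b where "b = f_reg w + complex_of_real (sqrt 3 * \<mu> - sqrt 3 / 2)"
  have d: "d \<noteq> 0" unfolding d_def by (rule f_star_nonzero[OF assms])
  have "(cmod d)\<^sup>2 * (cmod (W / cnj d))\<^sup>2 = (cmod W)\<^sup>2"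
    using d by (simp add: norm_divide power_divide)
  moreover have "(cmod d)\<^sup>2 * Im (b * cnj (W / cnj d)) = Im (b * cnj (d * W))"
  proof -
    have "of_real ((cmod d)\<^sup>2) * (b * cnj (W / cnj d)) = b * cnj (d * W)"
      using d unfolding complex_norm_square by simp
    then show ?thesis by (metis Im_complex_of_real Re_complex_of_real times_complex.sel(2) add_0_right mult_zero_left)
  qed
  moreover have "(cmod d)\<^sup>2 * potential \<mu> (f_reg w) = potential_reg \<mu> w"
    unfolding d_def by (rule potential_regularized[OF assms])
  ultimately show ?thesis
    unfolding H_bar_def H_ext_def hamiltonian_def d_def[symmetric] b_def[symmetric]
    by (simp add: algebra_simps)
qed

text \<open>Completing the square turns the inversion of \<open>f_reg\<close> into the extraction of one square root; it
  serves both for the preimage of a point and for the lift of a path.\<close>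

lemma f_reg_eq_iff: "w \<noteq> 0 \<and> f_reg w = u \<longleftrightarrow> (w - u)\<^sup>2 = u\<^sup>2 + 1 / 4"
proof -
  have "(w - u)\<^sup>2 = u\<^sup>2 + 1 / 4 \<longleftrightarrow> 4 * ((w - u)\<^sup>2 - (u\<^sup>2 + 1 / 4)) = 0"
    by (simp only: mult_eq_0_iff right_minus_eq) simp
  also have "4 * ((w - u)\<^sup>2 - (u\<^sup>2 + 1 / 4)) = w * (4 * w) - 1 - 2 * u * (4 * w)"
    by (simp add: power2_eq_square algebra_simps)
  also have "\<dots> = 0 \<longleftrightarrow> w * (4 * w) - 1 = 2 * u * (4 * w)"
    by (rule right_minus_eq)
  also have "\<dots> \<longleftrightarrow> w \<noteq> 0 \<and> f_reg w = u"
    by (auto simp: f_reg_def divide_simps)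
  finally show ?thesis by blast
qed

section \<open>Gradients and continuously differentiable functions\<close>

text \<open>A pair of position and momentum is treated as a point of the Euclidean space
  \<open>complex \<times> complex\<close>. Its inner product is the sum of the real inner products of the components, so
  the two components of the gradient are the complex numbers in which the partial derivatives are
  collected.\<close>

lemma GDERIV_imp_has_partials:
  assumes "GDERIV (\<lambda>(q, p). F q p) (q, p) :> (G, K)"
  shows "has_partials F q p G K"
proof -
  have FD: "((\<lambda>(q, p). F q p) has_derivative (\<lambda>h. inner h (G, K))) (at (q, p))"
    using assms by (simp add: gderiv_def)
  have line: "((\<lambda>x. F (fst (l x)) (snd (l x))) has_real_derivative inner v (G, K)) (at a)"
    if "l a = (q, p)" "(l has_vector_derivative v) (at a)" for l :: "real \<Rightarrow> complex \<times> complex" and v a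
  proof -
    have "((\<lambda>(q, p). F q p) has_derivative (\<lambda>h. inner h (G, K))) (at (l a))"
      using FD that(1) by simp
    from diff_chain_at[OF that(2)[unfolded has_vector_derivative_def] this]
    show ?thesis
      by (simp add: has_field_derivative_def o_def case_prod_beta mult_commute_abs)
  qed
  have Cx: "((\<lambda>x. Complex x b) has_vector_derivative 1) (at a)"
    and Cy: "((\<lambda>y. Complex b y) has_vector_derivative \<i>) (at a)" for a b :: real
    unfolding Complex_eq by (auto intro!: derivative_eq_intros)
  note vd = has_vector_derivative_Pair has_vector_derivative_const
  show ?thesis
    unfolding has_partials_def
    using line[of "\<lambda>x. (Complex x (Im q), p)", OF _ vd(1)[OF Cx vd(2)]]
      line[of "\<lambda>y. (Complex (Re q) y, p)", OF _ vd(1)[OF Cy vd(2)]]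
      line[of "\<lambda>x. (q, Complex x (Im p))", OF _ vd(1)[OF vd(2) Cx]]
      line[of "\<lambda>y. (q, Complex (Re p) y)", OF _ vd(1)[OF vd(2) Cy]]
    by (simp add: inner_complex_def)
qed

lemma has_partials_unique:
  assumes "has_partials F q p G K" "has_partials F q p G' K'"
  shows "G = G'" "K = K'"
  using assms unfolding has_partials_def by (auto intro!: complex_eqI dest: DERIV_unique)

text \<open>Existence of a continuous gradient is used instead of explicit formulas for the partial
  derivatives: the class is closed under the operations that build the Hamiltonians.\<close>

definition C1_on :: "'a::real_inner set \<Rightarrow> ('a \<Rightarrow> real) \<Rightarrow> bool" where
  "C1_on S F \<longleftrightarrow> (\<exists>D. continuous_on S D \<and> (\<forall>x\<in>S. GDERIV F x :> D x))"

definition C1_complex_on :: "'a::real_inner set \<Rightarrow> ('a \<Rightarrow> complex) \<Rightarrow> bool" where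
  "C1_complex_on S \<phi> \<longleftrightarrow> C1_on S (\<lambda>x. Re (\<phi> x)) \<and> C1_on S (\<lambda>x. Im (\<phi> x))"

lemma C1_on_imp_continuous_on: "C1_on S F \<Longrightarrow> continuous_on S F"
  unfolding C1_on_def gderiv_def
  by (blast intro: continuous_at_imp_continuous_on has_derivative_continuous)

lemma C1_on_const: "C1_on S (\<lambda>x. c)"
  unfolding C1_on_def by (rule exI[of _ "\<lambda>_. 0"]) (auto simp: GDERIV_const)

lemma C1_on_inner: "C1_on S (\<lambda>x. inner x v)"
  unfolding C1_on_def gderiv_def
  by (rule exI[of _ "\<lambda>_. v"])
    (auto intro!: bounded_linear_imp_has_derivative bounded_linear_inner_left)

lemma C1_on_add: "C1_on S F \<Longrightarrow> C1_on S G \<Longrightarrow> C1_on S (\<lambda>x. F x + G x)"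
  unfolding C1_on_def by (blast intro: GDERIV_add continuous_on_add)

lemma C1_on_minus: "C1_on S F \<Longrightarrow> C1_on S (\<lambda>x. - F x)"
  unfolding C1_on_def by (blast intro: GDERIV_minus continuous_on_minus)

lemma C1_on_diff: "C1_on S F \<Longrightarrow> C1_on S G \<Longrightarrow> C1_on S (\<lambda>x. F x - G x)"
  using C1_on_add[OF _ C1_on_minus] by fastforce

lemma C1_on_mult:
  assumes F: "C1_on S F" and G: "C1_on S G"
  shows "C1_on S (\<lambda>x. F x * G x)"
proof -
  obtain D E where "continuous_on S D" "continuous_on S E"
    and "\<forall>x\<in>S. GDERIV F x :> D x" "\<forall>x\<in>S. GDERIV G x :> E x"
    using F G unfolding C1_on_def by blast
  then show ?thesis
    unfolding C1_on_def using C1_on_imp_continuous_on[OF F] C1_on_imp_continuous_on[OF G]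
    by (intro exI[of _ "\<lambda>x. F x *\<^sub>R E x + G x *\<^sub>R D x"] conjI ballI)
      (auto intro!: continuous_intros GDERIV_mult)
qed

lemma C1_on_compose:
  fixes g :: "real \<Rightarrow> real"
  assumes F: "C1_on S F" and g: "\<And>x. x \<in> S \<Longrightarrow> (g has_real_derivative g' (F x)) (at (F x))"
    and g': "continuous_on (F ` S) g'"
  shows "C1_on S (\<lambda>x. g (F x))"
proof -
  obtain D where D: "continuous_on S D" "\<And>x. x \<in> S \<Longrightarrow> GDERIV F x :> D x"
    using F unfolding C1_on_def by blast
  have "continuous_on S (\<lambda>x. g' (F x))"
    using continuous_on_compose[OF C1_on_imp_continuous_on[OF F] g'] by (simp add: o_def)
  then have "continuous_on S (\<lambda>x. g' (F x) *\<^sub>R D x)"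
    using D(1) by (rule continuous_on_scaleR)
  moreover have "GDERIV (\<lambda>x. g (F x)) x :> g' (F x) *\<^sub>R D x" if "x \<in> S" for x
    using D(2)[OF that] g[OF that] by (rule GDERIV_DERIV_compose)
  ultimately show ?thesis
    unfolding C1_on_def by blast
qed

lemma C1_on_inverse:
  assumes "C1_on S F" "\<And>x. x \<in> S \<Longrightarrow> F x \<noteq> 0"
  shows "C1_on S (\<lambda>x. inverse (F x))"
  by (rule C1_on_compose[OF assms(1), where g' = "\<lambda>y. - (inverse y)\<^sup>2"])
    (use assms(2) in \<open>auto intro!: derivative_eq_intros continuous_intros simp: power2_eq_square\<close>)

lemma C1_on_divide:
  assumes "C1_on S F" "C1_on S G" "\<And>x. x \<in> S \<Longrightarrow> G x \<noteq> 0"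
  shows "C1_on S (\<lambda>x. F x / G x)"
  using C1_on_mult[OF assms(1) C1_on_inverse[OF assms(2,3)]] by (simp add: divide_inverse)

lemma C1_on_power: "C1_on S F \<Longrightarrow> C1_on S (\<lambda>x. F x ^ n)"
  by (induction n) (auto intro: C1_on_const C1_on_mult)

lemma C1_on_cong:
  assumes "C1_on S F" "open S" "\<And>x. x \<in> S \<Longrightarrow> F x = G x"
  shows "C1_on S G"
  using assms unfolding C1_on_def gderiv_def
  by (blast intro: has_derivative_transform_within_open)

lemma C1_complex_on_const: "C1_complex_on S (\<lambda>x. c)"
  by (simp add: C1_complex_on_def C1_on_const)

lemma C1_complex_on_add: "C1_complex_on S \<phi> \<Longrightarrow> C1_complex_on S \<psi> \<Longrightarrow> C1_complex_on S (\<lambda>x. \<phi> x + \<psi> x)"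
  by (simp add: C1_complex_on_def C1_on_add)

lemma C1_complex_on_diff: "C1_complex_on S \<phi> \<Longrightarrow> C1_complex_on S \<psi> \<Longrightarrow> C1_complex_on S (\<lambda>x. \<phi> x - \<psi> x)"
  by (simp add: C1_complex_on_def C1_on_diff)

lemma C1_complex_on_cnj: "C1_complex_on S \<phi> \<Longrightarrow> C1_complex_on S (\<lambda>x. cnj (\<phi> x))"
  by (simp add: C1_complex_on_def C1_on_minus)

lemma C1_complex_on_mult: "C1_complex_on S \<phi> \<Longrightarrow> C1_complex_on S \<psi> \<Longrightarrow> C1_complex_on S (\<lambda>x. \<phi> x * \<psi> x)"
  by (simp add: C1_complex_on_def C1_on_add C1_on_diff C1_on_mult)

lemma C1_complex_on_power: "C1_complex_on S \<phi> \<Longrightarrow> C1_complex_on S (\<lambda>x. \<phi> x ^ n)"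
  by (induction n) (auto intro: C1_complex_on_const C1_complex_on_mult)

lemma C1_complex_on_divide:
  assumes "C1_complex_on S \<phi>" "C1_complex_on S \<psi>" "\<And>x. x \<in> S \<Longrightarrow> \<psi> x \<noteq> 0"
  shows "C1_complex_on S (\<lambda>x. \<phi> x / \<psi> x)"
proof -
  have "C1_on S (\<lambda>x. inverse ((Re (\<psi> x))\<^sup>2 + (Im (\<psi> x))\<^sup>2))"
  proof (rule C1_on_inverse)
    show "C1_on S (\<lambda>x. (Re (\<psi> x))\<^sup>2 + (Im (\<psi> x))\<^sup>2)"
      using assms(2) unfolding C1_complex_on_def by (intro C1_on_add C1_on_power) auto
    show "(Re (\<psi> x))\<^sup>2 + (Im (\<psi> x))\<^sup>2 \<noteq> 0" if "x \<in> S" for x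
      using assms(3)[OF that] by (simp add: complex_eq_iff sum_power2_eq_zero_iff)
  qed
  then have "C1_complex_on S (\<lambda>x. inverse (\<psi> x))"
    using assms(2) unfolding C1_complex_on_def by (auto simp: divide_inverse C1_on_mult C1_on_minus)
  from C1_complex_on_mult[OF assms(1) this] show ?thesis by (simp add: divide_inverse)
qed

lemma C1_on_cmod:
  assumes "C1_complex_on S \<phi>" "\<And>x. x \<in> S \<Longrightarrow> \<phi> x \<noteq> 0"
  shows "C1_on S (\<lambda>x. cmod (\<phi> x))"
  unfolding cmod_def
proof (rule C1_on_compose[where g = sqrt and g' = "\<lambda>y. inverse (sqrt y) / 2"])
  show "C1_on S (\<lambda>x. (Re (\<phi> x))\<^sup>2 + (Im (\<phi> x))\<^sup>2)"
    using assms unfolding C1_complex_on_def by (intro C1_on_add C1_on_power) auto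
  show "(sqrt has_real_derivative inverse (sqrt ((Re (\<phi> x))\<^sup>2 + (Im (\<phi> x))\<^sup>2)) / 2)
      (at ((Re (\<phi> x))\<^sup>2 + (Im (\<phi> x))\<^sup>2))" if "x \<in> S" for x
    using assms(2)[OF that] by (intro DERIV_real_sqrt) (simp add: complex_neq_0)
  show "continuous_on ((\<lambda>x. (Re (\<phi> x))\<^sup>2 + (Im (\<phi> x))\<^sup>2) ` S) (\<lambda>y. inverse (sqrt y) / 2)"
    using assms(2) by (auto intro!: continuous_intros simp: complex_eq_iff sum_power2_eq_zero_iff)
qed

lemma C1_complex_on_fst: "C1_complex_on S (fst :: complex \<times> complex \<Rightarrow> complex)"
  using C1_on_inner[of S "(1, 0) :: complex \<times> complex"] C1_on_inner[of S "(\<i>, 0) :: complex \<times> complex"]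
  by (simp add: C1_complex_on_def inner_prod_def inner_complex_def)

lemma C1_complex_on_snd: "C1_complex_on S (snd :: complex \<times> complex \<Rightarrow> complex)"
  using C1_on_inner[of S "(0, 1) :: complex \<times> complex"] C1_on_inner[of S "(0, \<i>) :: complex \<times> complex"]
  by (simp add: C1_complex_on_def inner_prod_def inner_complex_def)

lemma C1_on_Re: "C1_complex_on S \<phi> \<Longrightarrow> C1_on S (\<lambda>x. Re (\<phi> x))"
  and C1_on_Im: "C1_complex_on S \<phi> \<Longrightarrow> C1_on S (\<lambda>x. Im (\<phi> x))"
  unfolding C1_complex_on_def by blast+

lemma C1_complex_on_cong:
  assumes "C1_complex_on S \<phi>" "open S" "\<And>x. x \<in> S \<Longrightarrow> \<phi> x = \<psi> x"
  shows "C1_complex_on S \<psi>"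
  unfolding C1_complex_on_def
proof
  show "C1_on S (\<lambda>x. Re (\<psi> x))"
    by (rule C1_on_cong[OF C1_on_Re[OF assms(1)] assms(2)]) (rule arg_cong[OF assms(3)])
  show "C1_on S (\<lambda>x. Im (\<psi> x))"
    by (rule C1_on_cong[OF C1_on_Im[OF assms(1)] assms(2)]) (rule arg_cong[OF assms(3)])
qed

lemmas C1_on_intros = C1_on_const C1_on_add C1_on_diff C1_on_mult C1_on_divide C1_on_power
  C1_on_Re C1_on_Im C1_on_cmod C1_complex_on_const C1_complex_on_add C1_complex_on_diff C1_complex_on_mult C1_complex_on_divide
  C1_complex_on_power C1_complex_on_cnj C1_complex_on_fst C1_complex_on_snd

text \<open>The gradient makes the chain rule available for compositions with the Hamiltonian; partial
  derivatives alone would not give it.\<close>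

lemma C1_hamiltonian: "C1_on ((- sing) \<times> UNIV) (\<lambda>(q, p). hamiltonian \<mu> q p)"
  unfolding case_prod_beta hamiltonian_def potential_def cmod_power2
  by (intro C1_on_intros) (auto simp: sing_def)

lemma C1_H_ext: "C1_on ((- {0, a\<^sub>1, a\<^sub>2}) \<times> UNIV) (\<lambda>(w, W). H_ext \<mu> C w W)"
    (is "C1_on ?S _")
proof -
  have "C1_complex_on ?S (\<lambda>x. (fst x - u\<^sub>2) * (fst x - u\<^sub>3) / (2 * (fst x)\<^sup>2))"
    by (intro C1_on_intros) auto
  then have C1_f_star: "C1_complex_on ?S (\<lambda>x. f_star (fst x))"
    by (rule C1_complex_on_cong) (auto simp: f_star_eq intro!: open_Times)
  have C1_f_reg: "C1_complex_on ?S (\<lambda>x. f_reg (fst x))"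
    unfolding f_reg_def by (intro C1_on_intros) auto
  show ?thesis
    unfolding case_prod_beta H_ext_def potential_reg_def cmod_power2
    by (intro C1_on_intros C1_f_reg C1_f_star) auto
qed

section \<open>The canonical transformation with rescaled time\<close>

lemma inner_complex_eq_Re: "inner a b = Re (a * cnj b)"
  by (simp add: inner_complex_def)

text \<open>The product rule would give one more term, the gradient of the factor \<open>\<bar>d w\<bar>\<^sup>2\<close> times \<open>H - c\<close>; it
  vanishes because the point lies on the level \<open>H = c\<close>. This is why the time change preserves the
  Hamiltonian form on a single energy level only. What remains is the chain rule, where \<open>d\<close> is
  the derivative of \<open>f\<close> and \<open>e\<close> the second derivative.\<close>

lemma GDERIV_rescaled:
  fixes H :: "complex \<Rightarrow> complex \<Rightarrow> real" and f d :: "complex \<Rightarrow> complex"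
  assumes f: "(f has_field_derivative d w) (at w)"
    and d: "(d has_field_derivative e) (at w)" and nz: "d w \<noteq> 0"
    and H: "GDERIV (\<lambda>(q, p). H q p) (f w, W / cnj (d w)) :> (G, K)"
    and level: "H (f w) (W / cnj (d w)) = c"
  shows "GDERIV (\<lambda>(w, W). (cmod (d w))\<^sup>2 * (H (f w) (W / cnj (d w)) - c)) (w, W) :>
    ((cmod (d w))\<^sup>2 *\<^sub>R (G * cnj (d w)) - d w * cnj (K * e) * (W / cnj (d w)), K * cnj (d w))"
proof -
  have ff: "((\<lambda>x. f (fst x)) has_derivative (\<lambda>h. d w * fst h)) (at (w, W))"
    by (rule has_derivative_compose[OF has_derivative_fst[OF has_derivative_ident], of f "\<lambda>h. d w * h", simplified])
      (use f in \<open>simp add: has_field_derivative_def\<close>)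
  have dd: "((\<lambda>x. d (fst x)) has_derivative (\<lambda>h. e * fst h)) (at (w, W))"
    by (rule has_derivative_compose[OF has_derivative_fst[OF has_derivative_ident], of d "\<lambda>h. e * h", simplified])
      (use d in \<open>simp add: has_field_derivative_def\<close>)
  have pp: "((\<lambda>x. snd x / cnj (d (fst x))) has_derivative
      (\<lambda>h. - W * (inverse (cnj (d w)) * cnj (e * fst h) * inverse (cnj (d w))) + snd h / cnj (d w))) (at (w, W))"
    using has_derivative_divide[OF has_derivative_snd[OF has_derivative_ident] has_derivative_cnj[OF dd]] nz
    by simp
  have "((\<lambda>x. (f (fst x), snd x / cnj (d (fst x)))) has_derivative
      (\<lambda>h. (d w * fst h, - W * (inverse (cnj (d w)) * cnj (e * fst h) * inverse (cnj (d w))) + snd h / cnj (d w))))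
      (at (w, W))"
    by (rule has_derivative_Pair[OF ff pp])
  from has_derivative_compose[OF this, of "\<lambda>(q, p). H q p" "\<lambda>h. inner h (G, K)"]
  have HH: "((\<lambda>x. H (f (fst x)) (snd x / cnj (d (fst x)))) has_derivative
      (\<lambda>h. inner (d w * fst h) G
        + inner (- W * (inverse (cnj (d w)) * cnj (e * fst h) * inverse (cnj (d w))) + snd h / cnj (d w)) K))
      (at (w, W))"
    using H by (simp add: gderiv_def inner_prod_def)
  have nn: "((\<lambda>x. (cmod (d (fst x)))\<^sup>2) has_derivative (\<lambda>h. 2 * inner (d w) (e * fst h))) (at (w, W))"
    unfolding power2_norm_eq_inner
    by (rule has_derivative_eq_rhs, rule has_derivative_inner[OF dd dd])
      (simp add: inner_commute)
  \<comment> \<open>With \<open>inner a b = Re (a * cnj b)\<close> the identity takes place under one real part. There the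
    term with \<open>e\<close> has to be conjugated, since \<open>h\<close> enters it through \<open>cnj h\<close>.\<close>
  have alg: "(cmod (d w))\<^sup>2 * (inner (d w * h) G
        + inner (- W * (inverse (cnj (d w)) * cnj (e * h) * inverse (cnj (d w))) + k / cnj (d w)) K)
      = inner h ((cmod (d w))\<^sup>2 *\<^sub>R (G * cnj (d w)) - d w * cnj (K * e) * (W / cnj (d w)))
        + inner k (K * cnj (d w))" for h k
  proof -
    have scale: "r * Re z = Re (of_real r * z)" for r z by simp
    define D D' where "D = d w" and "D' = cnj (d w)"
    have D: "D \<noteq> 0" "D' \<noteq> 0" "cnj D = D'" "cnj D' = D" using nz by (auto simp: D_def D'_def)
    have n: "of_real ((cmod (d w))\<^sup>2) = D * D'"
      unfolding D_def D'_def by (rule complex_norm_square)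
    have "(cmod (d w))\<^sup>2 * (inner (D * h) G
        + inner (- W * (inverse D' * cnj (e * h) * inverse D') + k / D') K)
        = Re (D * D' * (D * h * cnj G) - W * (D / D') * cnj (e * h) * cnj K + D * k * cnj K)"
      using D unfolding inner_complex_eq_Re plus_complex.sel(1)[symmetric] scale n
      by (intro arg_cong[of _ _ Re]) (simp add: field_simps)
    also have "\<dots> = Re (D * D' * (D * h * cnj G) - cnj (W * (D / D') * cnj (e * h) * cnj K) + D * k * cnj K)"
      by (simp only: minus_complex.sel plus_complex.sel cnj.sel)
    also have "\<dots> = inner h ((cmod (d w))\<^sup>2 *\<^sub>R (G * D') - D * cnj (K * e) * (W / D')) + inner k (K * D')"
      using D unfolding inner_complex_eq_Re plus_complex.sel(1)[symmetric] scaleR_conv_of_real n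
      by (intro arg_cong[of _ _ Re]) (simp add: field_simps)
    finally show ?thesis unfolding D_def D'_def .
  qed
  show ?thesis
    unfolding gderiv_def case_prod_beta
    by (rule has_derivative_eq_rhs,
        rule has_derivative_mult[OF nn has_derivative_diff[OF HH has_derivative_const]])
      (use level alg in \<open>auto simp: fun_eq_iff inner_prod_def\<close>)
qed

lemma C1_on_GDERIV_pair:
  assumes "C1_on S F" "x \<in> S"
  obtains G K where "GDERIV F x :> (G, K)"
  using assms unfolding C1_on_def by (metis surj_pair)

text \<open>The partial derivatives of the given Hamiltonian are only assumed; they are the components of its
  gradient because partial derivatives are unique, so the chain rule applies to them.\<close>

lemma H_bar_partials:
  assumes w: "w \<notin> sing_bar" and H: "hamiltonian \<mu> (f_reg w) (W / cnj (f_star w)) = - C / 2"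
    and part: "has_partials (hamiltonian \<mu>) (f_reg w) (W / cnj (f_star w)) G K"
  shows "has_partials (H_bar \<mu> C) w W
    ((cmod (f_star w))\<^sup>2 *\<^sub>R (G * cnj (f_star w))
       - f_star w * cnj (K * (- 1 / (4 * w ^ 3))) * (W / cnj (f_star w)))
    (K * cnj (f_star w))"
proof -
  have nz: "w \<noteq> 0" "f_reg w \<notin> sing" using w by (auto simp: not_sing_bar_iff)
  obtain G' K' where g: "GDERIV (\<lambda>(q, p). hamiltonian \<mu> q p) (f_reg w, W / cnj (f_star w)) :> (G', K')"
    using C1_on_GDERIV_pair[OF C1_hamiltonian] nz(2) by (metis ComplI SigmaI UNIV_I)
  have [simp]: "G' = G" "K' = K"
    using has_partials_unique[OF GDERIV_imp_has_partials[OF g] part] by auto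
  have "H_bar \<mu> C = (\<lambda>w W. (cmod (f_star w))\<^sup>2 * (hamiltonian \<mu> (f_reg w) (W / cnj (f_star w)) - (- C / 2)))"
    by (simp add: H_bar_def fun_eq_iff)
  moreover have "(f_reg has_field_derivative f_star w) (at w)"
    using f_reg_has_derivative[OF nz(1)] by (simp add: f_star_eq[OF nz(1)])
  ultimately show ?thesis
    using GDERIV_rescaled[where f = f_reg and d = f_star and H = "hamiltonian \<mu>" and w = w, OF _ f_star_has_derivative[OF nz(1)] f_star_nonzero[OF w] g H]
    by (intro GDERIV_imp_has_partials) simp
qed

lemma has_vector_derivative_iff_quotient:
  "(f has_vector_derivative v) (at t) \<longleftrightarrow> ((\<lambda>x. (f x - f t) /\<^sub>R (x - t)) \<longlongrightarrow> v) (at t)"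
proof -
  have "norm ((f x - f t) /\<^sub>R (x - t) - v) = norm (f x - f t - (x - t) *\<^sub>R v) / norm (x - t)"
    if "x \<noteq> t" for x
  proof -
    have "(f x - f t) /\<^sub>R (x - t) - v = (f x - f t - (x - t) *\<^sub>R v) /\<^sub>R (x - t)"
      using that by (simp add: scaleR_diff_right)
    then show ?thesis by (simp add: divide_inverse mult.commute)
  qed
  then have "((\<lambda>x. norm ((f x - f t) /\<^sub>R (x - t) - v)) \<longlongrightarrow> 0) (at t) \<longleftrightarrow>
      ((\<lambda>x. norm (f x - f t - (x - t) *\<^sub>R v) / norm (x - t)) \<longlongrightarrow> 0) (at t)"
    by (intro Lim_cong_within) auto
  then show ?thesis
    unfolding has_vector_derivative_def has_derivative_iff_norm
    by (simp add: bounded_linear_scaleR_left tendsto_norm_zero_iff LIM_zero_iff)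
qed

text \<open>Only continuity of the lift is assumed: Caratheodory's form of differentiability of the outer
  function turns the difference quotient of the composition into that of the lift.\<close>

lemma has_vector_derivative_lift:
  fixes f :: "complex \<Rightarrow> complex" and w :: "real \<Rightarrow> complex"
  assumes f: "(f has_field_derivative d) (at (w t))" and d: "d \<noteq> 0" and w: "isCont w t"
    and fw: "((\<lambda>x. f (w x)) has_vector_derivative v) (at t)"
  shows "(w has_vector_derivative v / d) (at t)"
proof -
  obtain g where g: "\<And>z. f z - f (w t) = g z * (z - w t)" "isCont g (w t)" "g (w t) = d"
    using f unfolding CARAT_DERIV by blast
  have lim: "((\<lambda>x. g (w x)) \<longlongrightarrow> d) (at t)"
    using isCont_o2[OF w g(2)] g(3) by (simp add: isCont_def)
  have "((\<lambda>x. (f (w x) - f (w t)) /\<^sub>R (x - t) / g (w x)) \<longlongrightarrow> v / d) (at t)"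
    using fw lim d unfolding has_vector_derivative_iff_quotient by (rule tendsto_divide)
  moreover have "\<forall>\<^sub>F x in at t. g (w x) \<noteq> 0"
    using lim d by (rule tendsto_imp_eventually_ne)
  then have "\<forall>\<^sub>F x in at t. (f (w x) - f (w t)) /\<^sub>R (x - t) / g (w x) = (w x - w t) /\<^sub>R (x - t)"
    by eventually_elim (simp add: g(1) scaleR_conv_of_real)
  ultimately show ?thesis
    unfolding has_vector_derivative_iff_quotient by (simp add: filterlim_cong)
qed

section \<open>Changes of time\<close>

lemma increasing_on_interval:
  fixes \<sigma> \<rho> :: "real \<Rightarrow> real"
  assumes I: "open I" "is_interval I"
    and der: "\<And>t. t \<in> I \<Longrightarrow> (\<sigma> has_real_derivative \<rho> t) (at t)"
    and pos: "\<And>t. t \<in> I \<Longrightarrow> \<rho> t > 0"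
  shows "inj_on \<sigma> I" and "open (\<sigma> ` I)" and "is_interval (\<sigma> ` I)"
    and "\<And>t. t \<in> I \<Longrightarrow> (inv_into I \<sigma> has_real_derivative inverse (\<rho> t)) (at (\<sigma> t))"
proof -
  have cont: "continuous_on I \<sigma>"
    using der DERIV_isCont continuous_at_imp_continuous_on by blast
  have "\<sigma> a < \<sigma> b" if "a \<in> I" "b \<in> I" "a < b" for a b
  proof (rule DERIV_pos_imp_increasing[OF \<open>a < b\<close>])
    fix x assume "a \<le> x" "x \<le> b"
    then have "x \<in> I" using that I(2) unfolding is_interval_1 by blast
    then show "\<exists>y. (\<sigma> has_real_derivative y) (at x) \<and> 0 < y" using der pos by blast
  qed
  then show inj: "inj_on \<sigma> I"
    by (intro strict_mono_on_imp_inj_on strict_mono_onI)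
  show op: "open (\<sigma> ` I)"
    by (rule invariance_of_domain[OF cont I(1) inj])
  show "is_interval (\<sigma> ` I)"
    using connected_continuous_image[OF cont] I(2) by (simp add: is_interval_connected_1)
  fix t assume t: "t \<in> I"
  show "(inv_into I \<sigma> has_real_derivative inverse (\<rho> t)) (at (\<sigma> t))"
  proof -
    obtain e where e: "e > 0" "cball t e \<subseteq> I" using I(1) t open_contains_cball by blast
    obtain r where r: "r > 0" "ball (\<sigma> t) r \<subseteq> \<sigma> ` I"
      using op t open_contains_ball by blast
    have near: "z \<in> I" if "\<bar>z - t\<bar> \<le> e" for z
      using e(2) that by (auto simp: subset_iff dist_real_def)
    have "isCont \<sigma> z" if "\<bar>z - t\<bar> \<le> e" for z
      using DERIV_isCont[OF der[OF near[OF that]]] .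
    then have "isCont (inv_into I \<sigma>) (\<sigma> t)"
      by (intro isCont_inverse_function[where f = \<sigma> and x = t, OF e(1)])
        (simp_all add: near inj)
    moreover have "\<sigma> (inv_into I \<sigma> y) = y" if "\<sigma> t - r < y" "y < \<sigma> t + r" for y
      using r(2) that by (intro f_inv_into_f) (auto simp: subset_iff dist_real_def)
    moreover have "(\<sigma> has_real_derivative \<rho> t) (at (inv_into I \<sigma> (\<sigma> t)))"
      using der t inj by simp
    moreover have "\<rho> t \<noteq> 0" using pos[OF t] by simp
    ultimately show ?thesis
      using r(1) by (intro DERIV_inverse_function[where a = "\<sigma> t - r" and b = "\<sigma> t + r"]) auto
  qed
qed

text \<open>An open interval need not contain its endpoints, so the integral is taken from the inner point
  \<open>t0\<close>, with the sign reversed to the left of it. Near each point it differs by a constant from an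
  integral over a compact interval.\<close>

lemma antiderivative_on_interval:
  fixes \<rho> :: "real \<Rightarrow> real"
  assumes I: "open I" "is_interval I" and \<rho>: "continuous_on I \<rho>" and t0: "t0 \<in> I"
  obtains \<sigma> where "\<sigma> t0 = \<tau>0" "\<And>t. t \<in> I \<Longrightarrow> (\<sigma> has_real_derivative \<rho> t) (at t)"
proof -
  define \<sigma> where "\<sigma> x = \<tau>0 + (if t0 \<le> x then integral {t0..x} \<rho> else - integral {x..t0} \<rho>)" for x
  have "(\<sigma> has_real_derivative \<rho> t) (at t)" if t: "t \<in> I" for t
  proof -
    obtain e where e: "e > 0" "cball (min t t0) e \<subseteq> I"
      using I(1) t t0 open_contains_cball by (metis min_def)
    obtain e' where e': "e' > 0" "cball (max t t0) e' \<subseteq> I"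
      using I(1) t t0 open_contains_cball by (metis max_def)
    define a b where "a = min t t0 - e" and "b = max t t0 + e'"
    have ab: "a \<in> I" "b \<in> I" "a < t" "t < b" "a < t0" "t0 < b"
      using e e' by (auto simp: a_def b_def subset_iff dist_real_def)
    have "{a..b} \<subseteq> I"
      using ab I(2) unfolding is_interval_1 by (meson atLeastAtMost_iff subsetI)
    then have cont: "continuous_on {a..b} \<rho>" using \<rho> continuous_on_subset by blast
    have eq: "\<tau>0 + (integral {a..x} \<rho> - integral {a..t0} \<rho>) = \<sigma> x" if x: "x \<in> {a<..<b}" for x
    proof (cases "t0 \<le> x")
      case True
      have "\<rho> integrable_on {a..x}"
        using cont x by (intro integrable_continuous_real continuous_on_subset[OF cont]) auto
      then have "integral {a..t0} \<rho> + integral {t0..x} \<rho> = integral {a..x} \<rho>"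
        using ab True by (intro Henstock_Kurzweil_Integration.integral_combine) auto
      then show ?thesis using True by (simp add: \<sigma>_def)
    next
      case False
      have "\<rho> integrable_on {a..t0}"
        using cont ab by (intro integrable_continuous_real continuous_on_subset[OF cont]) auto
      then have "integral {a..x} \<rho> + integral {x..t0} \<rho> = integral {a..t0} \<rho>"
        using x False by (intro Henstock_Kurzweil_Integration.integral_combine) auto
      then show ?thesis using False by (simp add: \<sigma>_def)
    qed
    have "((\<lambda>x. integral {a..x} \<rho>) has_real_derivative \<rho> t) (at t)"
      using integral_has_real_derivative[OF cont, of t] ab by (simp add: at_within_Icc_at)
    then have "((\<lambda>x. \<tau>0 + (integral {a..x} \<rho> - integral {a..t0} \<rho>)) has_real_derivative \<rho> t) (at t)"
      by (auto intro!: derivative_eq_intros)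
    then show ?thesis
      by (rule has_field_derivative_transform_within_open[where S = "{a<..<b}"])
        (use ab eq in auto)
  qed
  moreover have "\<sigma> t0 = \<tau>0" by (simp add: \<sigma>_def)
  ultimately show ?thesis using that by blast
qed

section \<open>Lifts of solutions\<close>

text \<open>By completing the square a lift of \<open>u\<close> is \<open>u + h\<close> with \<open>h\<^sup>2 = u\<^sup>2 + 1 / 4 = (u - u\<^sub>2) * (u - u\<^sub>3)\<close>. Along a
  path that avoids \<open>u\<^sub>2\<close> and \<open>u\<^sub>3\<close> this has no zero, hence it has a continuous square root on the
  interval; the prescribed initial point selects its sign.\<close>

lemma f_reg_path_lift:
  assumes u: "continuous_on I u" and I: "is_interval (I :: real set)" and t0: "t0 \<in> I"
    and sing: "\<And>t. t \<in> I \<Longrightarrow> u t \<notin> sing" and w0: "w0 \<notin> sing_bar" "f_reg w0 = u t0"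
  obtains w where "continuous_on I w" "w t0 = w0"
    "\<And>t. t \<in> I \<Longrightarrow> w t \<notin> sing_bar \<and> f_reg (w t) = u t"
proof -
  have "(u t)\<^sup>2 + 1 / 4 = (u t - u\<^sub>2) * (u t - u\<^sub>3)" for t
    by (simp add: u\<^sub>2_def u\<^sub>3_def power2_eq_square algebra_simps)
  then have "(u t)\<^sup>2 + 1 / 4 \<noteq> 0" if "t \<in> I" for t
    using sing[OF that] by (auto simp: sing_def)
  moreover have "continuous_on I (\<lambda>t. (u t)\<^sup>2 + 1 / 4)"
    by (intro continuous_intros u)
  moreover have "contractible I"
    using I by (simp add: convex_imp_contractible is_interval_convex)
  ultimately obtain h where h: "continuous_on I h" "\<And>t. t \<in> I \<Longrightarrow> (u t)\<^sup>2 + 1 / 4 = (h t)\<^sup>2"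
    using continuous_sqrt_on_contractible[of I "\<lambda>t. (u t)\<^sup>2 + 1 / 4"] by blast
  have "(w0 - u t0)\<^sup>2 = (h t0)\<^sup>2"
    using f_reg_eq_iff[of w0 "u t0"] w0 h(2)[OF t0] by (simp add: not_sing_bar_iff)
  \<comment> \<open>\<open>c\<close> is the sign of the root on the whole interval, decided at \<open>t0\<close>.\<close>
  then obtain c where c: "c = 1 \<or> c = - 1" "w0 - u t0 = c * h t0"
    by (metis mult_1 mult_minus_left power2_eq_iff)
  define w where "w t = u t + c * h t" for t
  have "w t \<noteq> 0 \<and> f_reg (w t) = u t" if "t \<in> I" for t
    unfolding f_reg_eq_iff using c(1) h(2)[OF that] by (auto simp: w_def)
  moreover have "continuous_on I w" unfolding w_def by (intro continuous_intros u h(1))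
  moreover have "w t0 = w0" using c(2) by (simp add: w_def algebra_simps)
  ultimately show ?thesis using that sing by (metis not_sing_bar_iff)
qed

lemma energy_level_iff:
  assumes "w \<notin> sing_bar"
  shows "hamiltonian \<mu> (f_reg w) (W / cnj (f_star w)) = - C / 2 \<longleftrightarrow> H_bar \<mu> C w W = 0"
  using f_star_nonzero[OF assms] by (auto simp: H_bar_def)

text \<open>In both directions the derivatives of one pair of curves are computed from those of the other by the
  chain rule and compared with the gradient in \<open>H_bar_partials\<close>. Passing to the regularized curves
  the chain rule cannot be applied to \<open>w\<close> directly, which is only known to be continuous; this is
  what \<open>has_vector_derivative_lift\<close> is for.\<close>

lemma corresponding_solutions:
  assumes corr: "corresponding_curves I J \<sigma> u U w W"
  shows "solution_on_level sing (hamiltonian \<mu>) (- C / 2) I u U \<longleftrightarrow>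
    solution_on_level sing_bar (H_bar \<mu> C) 0 J w W"
proof -
  have I: "open I" "is_interval I" and J: "open J" and bij: "bij_betw \<sigma> I J"
    and w_cont: "continuous_on J w" and w_ns: "\<And>\<tau>. \<tau> \<in> J \<Longrightarrow> w \<tau> \<notin> sing_bar"
    and \<sigma>: "\<And>t. t \<in> I \<Longrightarrow> (\<sigma> has_real_derivative 1 / (cmod (f_star (w (\<sigma> t))))\<^sup>2) (at t)"
    and u: "\<And>t. t \<in> I \<Longrightarrow> u t = f_reg (w (\<sigma> t))"
    and U: "\<And>t. t \<in> I \<Longrightarrow> U t = W (\<sigma> t) / cnj (f_star (w (\<sigma> t)))"
    using corr unfolding corresponding_curves_def by auto
  have \<sigma>J: "\<sigma> t \<in> J" if "t \<in> I" for t using bij that by (auto simp: bij_betw_def)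
  define s where "s = inv_into I \<sigma>"
  have s: "s \<tau> \<in> I" "\<sigma> (s \<tau>) = \<tau>" if "\<tau> \<in> J" for \<tau>
    using bij that by (auto simp: s_def bij_betw_def inv_into_into f_inv_into_f)
  have level: "hamiltonian \<mu> (u t) (U t) = - C / 2 \<longleftrightarrow> H_bar \<mu> C (w (\<sigma> t)) (W (\<sigma> t)) = 0"
    if "t \<in> I" for t
    using energy_level_iff[OF w_ns[OF \<sigma>J[OF that]]] by (simp add: u[OF that] U[OF that])
  have sq: "of_real ((cmod (f_star z))\<^sup>2) = f_star z * cnj (f_star z)" for z
    by (rule complex_norm_square)
  have f_star: "(f_reg has_field_derivative f_star (w \<tau>)) (at (w \<tau>))" "f_star (w \<tau>) \<noteq> 0"
    "(f_star has_field_derivative - 1 / (4 * (w \<tau>) ^ 3)) (at (w \<tau>))" if "\<tau> \<in> J" for \<tau>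
    using w_ns[OF that] f_reg_has_derivative f_star_eq f_star_nonzero f_star_has_derivative
    by (auto simp: not_sing_bar_iff)
  show ?thesis
  proof
    assume sol: "solution_on_level sing (hamiltonian \<mu>) (- C / 2) I u U"
    \<comment> \<open>From the physical to the regularized system: \<open>w\<close> is a lift of \<open>u \<circ> s\<close>, where \<open>s\<close> is the
      physical time, and \<open>W = (U \<circ> s) * cnj (f_star \<circ> w)\<close>.\<close>
    have "\<exists>G K. has_partials (H_bar \<mu> C) (w \<tau>) (W \<tau>) G K \<and>
        (w has_vector_derivative K) (at \<tau>) \<and> (W has_vector_derivative - G) (at \<tau>)"
      and "H_bar \<mu> C (w \<tau>) (W \<tau>) = 0" if \<tau>: "\<tau> \<in> J" for \<tau>
    proof -
      define t where "t = s \<tau>"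
      have t: "t \<in> I" "\<sigma> t = \<tau>" using s[OF \<tau>] by (auto simp: t_def)
      define D e where "D = f_star (w \<tau>)" and "e = - 1 / (4 * (w \<tau>) ^ 3)"
      have D: "D \<noteq> 0" using f_star(2)[OF \<tau>] by (simp add: D_def)
      obtain G K where part: "has_partials (hamiltonian \<mu>) (u t) (U t) G K"
        and u': "(u has_vector_derivative K) (at t)" and U': "(U has_vector_derivative - G) (at t)"
        and lev: "hamiltonian \<mu> (u t) (U t) = - C / 2"
        using sol t(1) unfolding solution_on_level_def hamiltonian_solution_def by blast
      show "H_bar \<mu> C (w \<tau>) (W \<tau>) = 0" using level[OF t(1)] lev t(2) by simp
      have "(s has_real_derivative inverse (1 / (cmod D)\<^sup>2)) (at (\<sigma> t))"
        unfolding s_def D_def t(2)[symmetric]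
        by (rule increasing_on_interval(4)[OF I \<sigma> _ t(1)]) (use f_star(2) \<sigma>J in auto)
      then have s': "(s has_vector_derivative (cmod D)\<^sup>2) (at \<tau>)"
        by (simp add: t(2) has_real_derivative_iff_has_vector_derivative)
      have us: "((\<lambda>x. u (s x)) has_vector_derivative (cmod D)\<^sup>2 *\<^sub>R K) (at \<tau>)"
        using vector_diff_chain_at[OF s'] u' by (simp add: t_def o_def)
      have Us: "((\<lambda>x. U (s x)) has_vector_derivative (cmod D)\<^sup>2 *\<^sub>R (- G)) (at \<tau>)"
        using vector_diff_chain_at[OF s', of U "- G"] U' by (simp add: t_def o_def)
      have "((\<lambda>x. f_reg (w x)) has_vector_derivative (cmod D)\<^sup>2 *\<^sub>R K) (at \<tau>)"
        by (rule has_vector_derivative_transform_within_open[OF us J \<tau>]) (simp add: u s)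
      then have "(w has_vector_derivative (cmod D)\<^sup>2 *\<^sub>R K / D) (at \<tau>)"
        using f_star(1)[OF \<tau>] D w_cont J \<tau> unfolding D_def
        by (intro has_vector_derivative_lift) (auto simp: continuous_on_eq_continuous_at)
      moreover have "(cmod D)\<^sup>2 *\<^sub>R K / D = K * cnj D"
        unfolding scaleR_conv_of_real complex_norm_square using D by simp
      ultimately have w': "(w has_vector_derivative K * cnj D) (at \<tau>)"
        by (simp only:)
      have "((\<lambda>x. cnj (f_star (w x))) has_vector_derivative cnj (K * cnj D * e)) (at \<tau>)"
        using has_vector_derivative_cnj[OF field_vector_diff_chain_at[OF w' f_star(3)[OF \<tau>]]]
        by (simp add: o_def e_def)
      from has_vector_derivative_mult[OF Us this]
      have "((\<lambda>x. U (s x) * cnj (f_star (w x))) has_vector_derivative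
          U t * cnj (K * cnj D * e) + (cmod D)\<^sup>2 *\<^sub>R (- G) * cnj D) (at \<tau>)"
        by (simp add: t_def D_def)
      then have "(W has_vector_derivative
          U t * cnj (K * cnj D * e) + (cmod D)\<^sup>2 *\<^sub>R (- G) * cnj D) (at \<tau>)"
        by (rule has_vector_derivative_transform_within_open[OF _ J \<tau>]) (simp add: U s f_star(2))
      also have "U t * cnj (K * cnj D * e) + (cmod D)\<^sup>2 *\<^sub>R (- G) * cnj D
          = - ((cmod D)\<^sup>2 *\<^sub>R (G * cnj D) - D * cnj (K * e) * (W \<tau> / cnj D))"
        using D by (simp add: U[OF t(1)] t(2) D_def[symmetric])
      finally have W': "(W has_vector_derivative
          - ((cmod D)\<^sup>2 *\<^sub>R (G * cnj D) - D * cnj (K * e) * (W \<tau> / cnj D))) (at \<tau>)" .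
      have "has_partials (H_bar \<mu> C) (w \<tau>) (W \<tau>)
          ((cmod D)\<^sup>2 *\<^sub>R (G * cnj D) - D * cnj (K * e) * (W \<tau> / cnj D)) (K * cnj D)"
        unfolding D_def e_def using H_bar_partials[OF w_ns[OF \<tau>]] lev part
        by (simp add: u[OF t(1)] U[OF t(1)] t(2))
      with w' W' show "\<exists>G K. has_partials (H_bar \<mu> C) (w \<tau>) (W \<tau>) G K \<and>
        (w has_vector_derivative K) (at \<tau>) \<and> (W has_vector_derivative - G) (at \<tau>)" by blast
    qed
    then show "solution_on_level sing_bar (H_bar \<mu> C) 0 J w W"
      unfolding solution_on_level_def hamiltonian_solution_def using w_ns by blast
  next
    assume sol: "solution_on_level sing_bar (H_bar \<mu> C) 0 J w W"
    \<comment> \<open>Conversely all curves are explicit compositions. The gradient of the physical Hamiltonian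
      exists anyway, and \<open>H_bar_partials\<close> expresses the given derivatives of \<open>w\<close> and \<open>W\<close> by it.\<close>
    have "\<exists>G K. has_partials (hamiltonian \<mu>) (u t) (U t) G K \<and>
        (u has_vector_derivative K) (at t) \<and> (U has_vector_derivative - G) (at t)"
      and "hamiltonian \<mu> (u t) (U t) = - C / 2" and "u t \<notin> sing" if t: "t \<in> I" for t
    proof -
      define \<tau> where "\<tau> = \<sigma> t"
      have \<tau>: "\<tau> \<in> J" using \<sigma>J[OF t] by (simp add: \<tau>_def)
      define D e where "D = f_star (w \<tau>)" and "e = - 1 / (4 * (w \<tau>) ^ 3)"
      have D: "D \<noteq> 0" using f_star(2)[OF \<tau>] by (simp add: D_def)
      obtain Gb Kb where part: "has_partials (H_bar \<mu> C) (w \<tau>) (W \<tau>) Gb Kb"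
        and w': "(w has_vector_derivative Kb) (at \<tau>)" and W': "(W has_vector_derivative - Gb) (at \<tau>)"
        and "H_bar \<mu> C (w \<tau>) (W \<tau>) = 0"
        using sol \<tau> unfolding solution_on_level_def hamiltonian_solution_def by blast
      then show lev: "hamiltonian \<mu> (u t) (U t) = - C / 2" using level[OF t] by (simp add: \<tau>_def)
      show ns: "u t \<notin> sing" using w_ns[OF \<tau>] by (simp add: u[OF t] \<tau>_def not_sing_bar_iff)
      obtain G K where "GDERIV (\<lambda>(q, p). hamiltonian \<mu> q p) (u t, U t) :> (G, K)"
        using C1_on_GDERIV_pair[OF C1_hamiltonian] ns by (metis ComplI SigmaI UNIV_I)
      then have H: "has_partials (hamiltonian \<mu>) (u t) (U t) G K"
        by (rule GDERIV_imp_has_partials)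
      have "has_partials (H_bar \<mu> C) (w \<tau>) (W \<tau>)
          ((cmod D)\<^sup>2 *\<^sub>R (G * cnj D) - D * cnj (K * e) * (W \<tau> / cnj D)) (K * cnj D)"
        unfolding D_def e_def using H_bar_partials[OF w_ns[OF \<tau>]] lev H
        by (simp add: u[OF t] U[OF t] \<tau>_def)
      then have Kb: "Kb = K * cnj D"
        and Gb: "Gb = (cmod D)\<^sup>2 *\<^sub>R (G * cnj D) - D * cnj (K * e) * (W \<tau> / cnj D)"
        using has_partials_unique[OF part] by auto
      have \<sigma>': "(\<sigma> has_vector_derivative 1 / (cmod D)\<^sup>2) (at t)"
        using \<sigma>[OF t] by (simp add: D_def \<tau>_def has_real_derivative_iff_has_vector_derivative)
      have inv: "complex_of_real (1 / (cmod D)\<^sup>2) = 1 / (D * cnj D)"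
        using sq[of "w \<tau>"] by (simp add: D_def flip: of_real_power)
      have "((\<lambda>x. w (\<sigma> x)) has_vector_derivative (1 / (cmod D)\<^sup>2) *\<^sub>R Kb) (at t)"
        using vector_diff_chain_at[OF \<sigma>'] w' by (simp add: \<tau>_def o_def)
      also have "(1 / (cmod D)\<^sup>2) *\<^sub>R Kb = K / D"
        unfolding scaleR_conv_of_real inv Kb using D by simp
      finally have w\<sigma>: "((\<lambda>x. w (\<sigma> x)) has_vector_derivative K / D) (at t)" .
      have W\<sigma>: "((\<lambda>x. W (\<sigma> x)) has_vector_derivative (1 / (cmod D)\<^sup>2) *\<^sub>R (- Gb)) (at t)"
        using vector_diff_chain_at[OF \<sigma>', of W "- Gb"] W' by (simp add: \<tau>_def o_def)
      have "((\<lambda>x. f_reg (w (\<sigma> x))) has_vector_derivative K) (at t)"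
        using field_vector_diff_chain_at[OF w\<sigma>, of f_reg D] f_star(1)[OF \<tau>] D
        by (simp add: o_def \<tau>_def D_def)
      then have u': "(u has_vector_derivative K) (at t)"
        by (rule has_vector_derivative_transform_within_open[OF _ I(1) t]) (simp add: u)
      have "((\<lambda>z. inverse (f_star z)) has_field_derivative - (e / D\<^sup>2)) (at (w (\<sigma> t)))"
        using DERIV_inverse_fun[OF f_star(3)[OF \<tau>] f_star(2)[OF \<tau>]]
        by (simp add: D_def e_def \<tau>_def divide_simps power2_eq_square)
      from has_vector_derivative_cnj[OF field_vector_diff_chain_at[OF w\<sigma> this]]
      have "((\<lambda>x. cnj (inverse (f_star (w (\<sigma> x))))) has_vector_derivative cnj (K / D * - (e / D\<^sup>2))) (at t)"
        by (simp add: o_def)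
      from has_vector_derivative_mult[OF W\<sigma> this]
      have "((\<lambda>x. W (\<sigma> x) * cnj (inverse (f_star (w (\<sigma> x))))) has_vector_derivative
          W \<tau> * cnj (K / D * - (e / D\<^sup>2)) + (1 / (cmod D)\<^sup>2) *\<^sub>R (- Gb) * cnj (inverse D)) (at t)"
        by (simp add: \<tau>_def D_def)
      also have "W \<tau> * cnj (K / D * - (e / D\<^sup>2)) + (1 / (cmod D)\<^sup>2) *\<^sub>R (- Gb) * cnj (inverse D) = - G"
      proof -
        have r: "complex_of_real ((cmod D)\<^sup>2) = D * cnj D" by (rule complex_norm_square)
        show ?thesis
          unfolding Gb scaleR_conv_of_real inv r using D
          by (simp add: field_simps power2_eq_square)
      qed
      finally have "(U has_vector_derivative - G) (at t)"
        by (rule has_vector_derivative_transform_within_open[OF _ I(1) t])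
          (simp add: U divide_inverse)
      with H u' show "\<exists>G K. has_partials (hamiltonian \<mu>) (u t) (U t) G K \<and>
        (u has_vector_derivative K) (at t) \<and> (U has_vector_derivative - G) (at t)" by blast
    qed
    then show "solution_on_level sing (hamiltonian \<mu>) (- C / 2) I u U"
      unfolding solution_on_level_def hamiltonian_solution_def by blast
  qed
qed

lemma continuous_on_f_star:
  assumes w: "continuous_on A w" and nz: "\<And>t. t \<in> A \<Longrightarrow> w t \<noteq> 0"
  shows "continuous_on A (\<lambda>t. f_star (w t))"
proof (rule continuous_on_eq)
  show "continuous_on A (\<lambda>t. (w t - u\<^sub>2) * (w t - u\<^sub>3) / (2 * (w t)\<^sup>2))"
    by (intro continuous_intros w) (simp add: nz)
qed (simp add: f_star_eq nz)

text \<open>The lift has to be constructed first as a curve in the physical time, because the new time is the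
  integral of \<open>1 / \<bar>f_star\<bar>\<^sup>2\<close> along it.\<close>

lemma lift_to_regularized_solution:
  assumes I: "open I" "is_interval I" and t0: "t0 \<in> I"
    and sol: "solution_on_level sing (hamiltonian \<mu>) (- C / 2) I u U"
    and w0: "w0 \<notin> sing_bar" "f_reg w0 = u t0"
  shows "\<exists>J \<sigma> w W. corresponding_curves I J \<sigma> u U w W \<and> \<sigma> t0 = \<tau>0 \<and> w \<tau>0 = w0 \<and>
    solution_on_level sing_bar (H_bar \<mu> C) 0 J w W"
proof -
  have u_ns: "u t \<notin> sing" and u_cont: "isCont u t" if "t \<in> I" for t
    using sol that unfolding solution_on_level_def hamiltonian_solution_def
    by (auto dest: has_vector_derivative_continuous)
  have "continuous_on I u" by (simp add: continuous_at_imp_continuous_on u_cont)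
  then obtain v where v: "continuous_on I v" "v t0 = w0"
    "\<And>t. t \<in> I \<Longrightarrow> v t \<notin> sing_bar \<and> f_reg (v t) = u t"
    using f_reg_path_lift[where u = u and I = I, OF _ I(2) t0 u_ns w0] by blast
  define \<rho> where "\<rho> t = 1 / (cmod (f_star (v t)))\<^sup>2" for t
  have v0: "v t \<noteq> 0" and f_star0: "f_star (v t) \<noteq> 0" if "t \<in> I" for t
    using v(3)[OF that] f_star_nonzero by (auto simp: not_sing_bar_iff)
  have "continuous_on I (\<lambda>t. f_star (v t))"
    by (rule continuous_on_f_star[OF v(1) v0])
  then have "continuous_on I \<rho>"
    unfolding \<rho>_def by (intro continuous_intros) (auto simp: f_star0)
  then obtain \<sigma> where \<sigma>: "\<sigma> t0 = \<tau>0" "\<And>t. t \<in> I \<Longrightarrow> (\<sigma> has_real_derivative \<rho> t) (at t)"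
    using antiderivative_on_interval[OF I _ t0] by blast
  have "\<rho> t > 0" if "t \<in> I" for t using f_star0[OF that] by (simp add: \<rho>_def)
  note inc = increasing_on_interval[OF I \<sigma>(2) this]
  define s where "s = inv_into I \<sigma>"
  have s: "s (\<sigma> t) = t" if "t \<in> I" for t using inc(1) that by (simp add: s_def)
  have "continuous_on (\<sigma> ` I) s"
    using inc(4) unfolding s_def
    by (intro continuous_at_imp_continuous_on) (auto intro: DERIV_isCont)
  then have "continuous_on (\<sigma> ` I) (\<lambda>\<tau>. v (s \<tau>))"
    by (rule continuous_on_compose2[OF v(1)]) (auto simp: s)
  then have "corresponding_curves I (\<sigma> ` I) \<sigma> u U
      (\<lambda>\<tau>. v (s \<tau>)) (\<lambda>\<tau>. U (s \<tau>) * cnj (f_star (v (s \<tau>))))"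
    unfolding corresponding_curves_def
    using I inc(1,2,3) v(3) \<sigma>(2) by (auto simp: inj_on_imp_bij_betw s f_star0 \<rho>_def)
  moreover have "v (s \<tau>0) = w0" using s[OF t0] \<sigma>(1) v(2) by simp
  ultimately show ?thesis using corresponding_solutions sol \<sigma>(1) by metis
qed

text \<open>Here the physical time is the integral of \<open>\<bar>f_star\<bar>\<^sup>2\<close> along the given curve, and \<open>\<sigma>\<close> is its
  inverse function.\<close>

lemma push_to_physical_solution:
  assumes J: "open J" "is_interval J" and \<tau>0: "\<tau>0 \<in> J"
    and sol: "solution_on_level sing_bar (H_bar \<mu> C) 0 J w W"
  shows "\<exists>I \<sigma> u U. corresponding_curves I J \<sigma> u U w W \<and> t0 \<in> I \<and> \<sigma> t0 = \<tau>0 \<and>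
    solution_on_level sing (hamiltonian \<mu>) (- C / 2) I u U"
proof -
  have w_ns: "w \<tau> \<notin> sing_bar" and w_isCont: "isCont w \<tau>" if "\<tau> \<in> J" for \<tau>
    using sol that unfolding solution_on_level_def hamiltonian_solution_def
    by (auto dest: has_vector_derivative_continuous)
  have w_cont: "continuous_on J w" by (simp add: continuous_at_imp_continuous_on w_isCont)
  define \<rho> where "\<rho> \<tau> = (cmod (f_star (w \<tau>)))\<^sup>2" for \<tau>
  have w0: "w \<tau> \<noteq> 0" and f_star0: "f_star (w \<tau>) \<noteq> 0" if "\<tau> \<in> J" for \<tau>
    using w_ns[OF that] f_star_nonzero by (auto simp: not_sing_bar_iff)
  have "continuous_on J (\<lambda>\<tau>. f_star (w \<tau>))"
    by (rule continuous_on_f_star[OF w_cont w0])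
  then have "continuous_on J \<rho>"
    unfolding \<rho>_def by (intro continuous_intros)
  then obtain s where s: "s \<tau>0 = t0" "\<And>\<tau>. \<tau> \<in> J \<Longrightarrow> (s has_real_derivative \<rho> \<tau>) (at \<tau>)"
    using antiderivative_on_interval[OF J _ \<tau>0] by blast
  have "\<rho> \<tau> > 0" if "\<tau> \<in> J" for \<tau> using f_star0[OF that] by (simp add: \<rho>_def)
  note inc = increasing_on_interval[OF J s(2) this]
  define \<sigma> where "\<sigma> = inv_into J s"
  have \<sigma>: "\<sigma> (s \<tau>) = \<tau>" if "\<tau> \<in> J" for \<tau> using inc(1) that by (simp add: \<sigma>_def)
  have "bij_betw \<sigma> (s ` J) J"
    unfolding \<sigma>_def by (intro bij_betw_inv_into inj_on_imp_bij_betw inc(1))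
  moreover have "(\<sigma> has_real_derivative 1 / (cmod (f_star (w (\<sigma> t))))\<^sup>2) (at t)" if t: "t \<in> s ` J" for t
  proof -
    obtain \<tau> where "\<tau> \<in> J" "t = s \<tau>" using t by blast
    then show ?thesis
      using inc(4)[of \<tau>] \<sigma>[of \<tau>] unfolding \<sigma>_def[symmetric] by (simp add: \<rho>_def inverse_eq_divide)
  qed
  ultimately have "corresponding_curves (s ` J) J \<sigma>
      (\<lambda>t. f_reg (w (\<sigma> t))) (\<lambda>t. W (\<sigma> t) / cnj (f_star (w (\<sigma> t)))) w W"
    unfolding corresponding_curves_def using J inc(2,3) w_cont w_ns by blast
  moreover have "t0 \<in> s ` J" "\<sigma> t0 = \<tau>0" using s(1) \<tau>0 \<sigma>[OF \<tau>0] by auto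
  ultimately show ?thesis using corresponding_solutions sol by metis
qed

section \<open>The extension and the theorem\<close>

lemma H_ext_continuous_partials:
  "\<exists>G K. continuous_on {(w, W). w \<notin> {0, a\<^sub>1, a\<^sub>2}} (\<lambda>(w, W). G w W) \<and>
    continuous_on {(w, W). w \<notin> {0, a\<^sub>1, a\<^sub>2}} (\<lambda>(w, W). K w W) \<and>
    (\<forall>w W. w \<notin> {0, a\<^sub>1, a\<^sub>2} \<longrightarrow> has_partials (H_ext \<mu> C) w W (G w W) (K w W))"
proof -
  have S: "(- {0, a\<^sub>1, a\<^sub>2}) \<times> UNIV = {(w, W :: complex). w \<notin> {0, a\<^sub>1, a\<^sub>2}}"
    by auto
  obtain D where D: "continuous_on {(w, W). w \<notin> {0, a\<^sub>1, a\<^sub>2}} D"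
    "\<And>x. x \<in> {(w, W). w \<notin> {0, a\<^sub>1, a\<^sub>2}} \<Longrightarrow> GDERIV (\<lambda>(w, W). H_ext \<mu> C w W) x :> D x"
    using C1_H_ext unfolding C1_on_def S by blast
  show ?thesis
  proof (rule exI[of _ "\<lambda>w W. fst (D (w, W))"], rule exI[of _ "\<lambda>w W. snd (D (w, W))"],
      intro conjI allI impI)
    show "has_partials (H_ext \<mu> C) w W (fst (D (w, W))) (snd (D (w, W)))"
      if "w \<notin> {0, a\<^sub>1, a\<^sub>2}" for w W
      using D(2)[of "(w, W)"] that by (intro GDERIV_imp_has_partials) simp
  qed (use D(1) in \<open>simp_all add: continuous_on_fst continuous_on_snd\<close>)
qed

lemma image_of_energy_level:
  "(\<lambda>(w, W). (f_reg w, W / cnj (f_star w))) ` {(w, W). w \<notin> sing_bar \<and> H_bar \<mu> C w W = 0}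
     = {(u, U). u \<notin> sing \<and> hamiltonian \<mu> u U = - C / 2}"
proof (intro set_eqI iffI; clarify)
  fix w W assume "w \<notin> sing_bar" "H_bar \<mu> C w W = 0"
  then show "f_reg w \<notin> sing \<and> hamiltonian \<mu> (f_reg w) (W / cnj (f_star w)) = - C / 2"
    using energy_level_iff by (simp add: not_sing_bar_iff)
next
  fix u U assume u: "u \<notin> sing" "hamiltonian \<mu> u U = - C / 2"
  \<comment> \<open>The preimage of \<open>u\<close> given by the principal square root.\<close>
  have "(u + csqrt (u\<^sup>2 + 1 / 4) - u)\<^sup>2 = u\<^sup>2 + 1 / 4" by simp
  then obtain w where w: "w \<notin> sing_bar" "f_reg w = u"
    using u(1) by (metis f_reg_eq_iff not_sing_bar_iff)
  have "U * cnj (f_star w) / cnj (f_star w) = U" using f_star_nonzero[OF w(1)] by simp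
  then show "(u, U) \<in> (\<lambda>(w, W). (f_reg w, W / cnj (f_star w))) `
      {(w, W). w \<notin> sing_bar \<and> H_bar \<mu> C w W = 0}"
    using w u(2) energy_level_iff[OF w(1), of \<mu> "U * cnj (f_star w)" C]
    by (intro image_eqI[of _ _ "(w, U * cnj (f_star w))"]) auto
qed

theorem mainTheorem1:
  fixes \<mu> C :: real
  assumes "0 \<le> \<mu>" and "\<mu> \<le> 1 / 2"
  shows
    "\<comment> \<open>(i): energy levels\<close>
     (\<forall>w W. w \<notin> sing_bar \<longrightarrow>
        (hamiltonian \<mu> (f_reg w) (W / cnj (f_star w)) = - C / 2 \<longleftrightarrow> H_bar \<mu> C w W = 0)) \<and>
     (\<lambda>(w, W). (f_reg w, W / cnj (f_star w))) ` {(w, W). w \<notin> sing_bar \<and> H_bar \<mu> C w W = 0}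
       = {(u, U). u \<notin> sing \<and> hamiltonian \<mu> u U = - C / 2} \<and>
     \<comment> \<open>(i): solutions\<close>
     (\<forall>I J \<sigma> u U w W. corresponding_curves I J \<sigma> u U w W \<longrightarrow>
        (solution_on_level sing (hamiltonian \<mu>) (- C / 2) I u U \<longleftrightarrow>
         solution_on_level sing_bar (H_bar \<mu> C) 0 J w W)) \<and>
     (\<forall>I u U t0 \<tau>0 w0. open I \<and> is_interval I \<and> t0 \<in> I \<and>
        solution_on_level sing (hamiltonian \<mu>) (- C / 2) I u U \<and>
        w0 \<notin> sing_bar \<and> f_reg w0 = u t0 \<longrightarrow>
        (\<exists>J \<sigma> w W. corresponding_curves I J \<sigma> u U w W \<and> \<sigma> t0 = \<tau>0 \<and> w \<tau>0 = w0 \<and>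
           solution_on_level sing_bar (H_bar \<mu> C) 0 J w W)) \<and>
     (\<forall>J w W t0 \<tau>0. open J \<and> is_interval J \<and> \<tau>0 \<in> J \<and>
        solution_on_level sing_bar (H_bar \<mu> C) 0 J w W \<longrightarrow>
        (\<exists>I \<sigma> u U. corresponding_curves I J \<sigma> u U w W \<and> t0 \<in> I \<and> \<sigma> t0 = \<tau>0 \<and>
           solution_on_level sing (hamiltonian \<mu>) (- C / 2) I u U)) \<and>
     \<comment> \<open>(ii)\<close>
     (\<forall>w W. w \<notin> sing_bar \<longrightarrow>
        H_bar \<mu> C w W =
          (cmod W)\<^sup>2 / 2
          + Im ((f_reg w + complex_of_real (sqrt 3 * \<mu> - sqrt 3 / 2)) * cnj (f_star w * W))
          - (cmod (f_star w))\<^sup>2 * potential \<mu> (f_reg w)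
          + (cmod (f_star w))\<^sup>2 * (C / 2) \<and>
        (cmod (f_star w))\<^sup>2 * potential \<mu> (f_reg w) =
          1 / (2 * (cmod w) ^ 3) *
            ((1 - 2 * \<mu>) * (cmod (w - u\<^sub>2))\<^sup>2 * (cmod (w - u\<^sub>3))\<^sup>2
               / (cmod (w - a\<^sub>1) * cmod (w - a\<^sub>2))
             + \<mu> * ((cmod (w - u\<^sub>2))\<^sup>2 + (cmod (w - u\<^sub>3))\<^sup>2))) \<and>
     \<comment> \<open>(iii): the collisions and the extension\<close>
     (\<forall>w. w \<noteq> 0 \<longrightarrow> (f_reg w = u\<^sub>2 \<longleftrightarrow> w = u\<^sub>2) \<and> (f_reg w = u\<^sub>3 \<longleftrightarrow> w = u\<^sub>3)) \<and>
     (\<forall>w W. w \<notin> sing_bar \<longrightarrow> H_ext \<mu> C w W = H_bar \<mu> C w W) \<and>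
     (\<exists>G K. continuous_on {(w, W). w \<notin> {0, a\<^sub>1, a\<^sub>2}} (\<lambda>(w, W). G w W) \<and>
        continuous_on {(w, W). w \<notin> {0, a\<^sub>1, a\<^sub>2}} (\<lambda>(w, W). K w W) \<and>
        (\<forall>w W. w \<notin> {0, a\<^sub>1, a\<^sub>2} \<longrightarrow> has_partials (H_ext \<mu> C) w W (G w W) (K w W)))"
proof (intro conjI allI impI)
  show "hamiltonian \<mu> (f_reg w) (W / cnj (f_star w)) = - C / 2 \<longleftrightarrow> H_bar \<mu> C w W = 0"
    if "w \<notin> sing_bar" for w W
    using that by (rule energy_level_iff)
  show "(\<lambda>(w, W). (f_reg w, W / cnj (f_star w))) ` {(w, W). w \<notin> sing_bar \<and> H_bar \<mu> C w W = 0}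
       = {(u, U). u \<notin> sing \<and> hamiltonian \<mu> u U = - C / 2}"
    by (rule image_of_energy_level)
  show "solution_on_level sing (hamiltonian \<mu>) (- C / 2) I u U \<longleftrightarrow>
         solution_on_level sing_bar (H_bar \<mu> C) 0 J w W"
    if "corresponding_curves I J \<sigma> u U w W" for I J \<sigma> u U w W
    using that by (rule corresponding_solutions)
  show "\<exists>J \<sigma> w W. corresponding_curves I J \<sigma> u U w W \<and> \<sigma> t0 = \<tau>0 \<and> w \<tau>0 = w0 \<and>
           solution_on_level sing_bar (H_bar \<mu> C) 0 J w W"
    if "open I \<and> is_interval I \<and> t0 \<in> I \<and>
        solution_on_level sing (hamiltonian \<mu>) (- C / 2) I u U \<and>
        w0 \<notin> sing_bar \<and> f_reg w0 = u t0" for I u U t0 \<tau>0 w0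
    using that by (intro lift_to_regularized_solution) auto
  show "\<exists>I \<sigma> u U. corresponding_curves I J \<sigma> u U w W \<and> t0 \<in> I \<and> \<sigma> t0 = \<tau>0 \<and>
           solution_on_level sing (hamiltonian \<mu>) (- C / 2) I u U"
    if "open J \<and> is_interval J \<and> \<tau>0 \<in> J \<and>
        solution_on_level sing_bar (H_bar \<mu> C) 0 J w W" for J w W t0 \<tau>0
    using that by (intro push_to_physical_solution) auto
  fix w W
  show "H_ext \<mu> C w W = H_bar \<mu> C w W" if "w \<notin> sing_bar"
    by (rule H_bar_eq[OF that, symmetric])
  assume w: "w \<notin> sing_bar"
  note pot = potential_regularized[OF w, of \<mu>]
  show "(cmod (f_star w))\<^sup>2 * potential \<mu> (f_reg w) =
          1 / (2 * (cmod w) ^ 3) *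
            ((1 - 2 * \<mu>) * (cmod (w - u\<^sub>2))\<^sup>2 * (cmod (w - u\<^sub>3))\<^sup>2
               / (cmod (w - a\<^sub>1) * cmod (w - a\<^sub>2))
             + \<mu> * ((cmod (w - u\<^sub>2))\<^sup>2 + (cmod (w - u\<^sub>3))\<^sup>2))"
    using pot unfolding potential_reg_def .
  show "H_bar \<mu> C w W =
          (cmod W)\<^sup>2 / 2
          + Im ((f_reg w + complex_of_real (sqrt 3 * \<mu> - sqrt 3 / 2)) * cnj (f_star w * W))
          - (cmod (f_star w))\<^sup>2 * potential \<mu> (f_reg w)
          + (cmod (f_star w))\<^sup>2 * (C / 2)"
    unfolding pot H_bar_eq[OF w] H_ext_def ..
next
  show "f_reg w = u\<^sub>2 \<longleftrightarrow> w = u\<^sub>2" "f_reg w = u\<^sub>3 \<longleftrightarrow> w = u\<^sub>3" if "w \<noteq> 0" for w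
    using f_reg_in_sing_iff[OF that] by auto
  show "\<exists>G K. continuous_on {(w, W). w \<notin> {0, a\<^sub>1, a\<^sub>2}} (\<lambda>(w, W). G w W) \<and>
        continuous_on {(w, W). w \<notin> {0, a\<^sub>1, a\<^sub>2}} (\<lambda>(w, W). K w W) \<and>
        (\<forall>w W. w \<notin> {0, a\<^sub>1, a\<^sub>2} \<longrightarrow> has_partials (H_ext \<mu> C) w W (G w W) (K w W))"
    by (rule H_ext_continuous_partials)
qed

end
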